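(* For every $\rho<\sqrt{6}$ there exist a finite ground set $E$, weights $w\colon E\to\mathbb{R}_{\geq0}$ and a monotone, $1$-bounded, fractionally subadditive objective $f\colon2^{E}\to\mathbb{R}_{\geq0}$ such that no incremental solution (ordering of $E$) is $\rho$-competitive.
   Context: $w(S):=\sum_{e\in S}w(e)$; $f^{*}(C):=\max\{f(S):S\subseteq E,w(S)\leq C\}$. An incremental solution is an ordering $\pi$ of $E$; $\pi(C)$ is the maximal prefix of $\pi$ with total weight at most $C$; $\pi$ is $\rho$-competitive if $f^{*}(C)\leq\rho f(\pi(C))$ for all $C>0$. Monotone: $f(A)\geq f(B)$ for $A\supseteq B$; $1$-bounded: $f(\{e\})=1$ for all $e\in E$; fractionally subadditive: $f(A)\leq\sum_{i}\alpha_{i}f(B_{i})$ for all $A,B_{1},\dots,B_{k}\subseteq E$ and $\alpha_{i}\geq0$ with $\sum_{i:e\in B_{i}}\alpha_{i}\geq1$ for all $e\in A$. *)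

theory Defs
  imports Complex_Main "HOL-Combinatorics.Multiset_Permutations"
begin

definition opt_value :: "'a set \<Rightarrow> ('a \<Rightarrow> real) \<Rightarrow> ('a set \<Rightarrow> real) \<Rightarrow> real \<Rightarrow> real" where
  "opt_value E w f C = Max {f S | S. S \<subseteq> E \<and> sum w S \<le> C}"

text \<open>An ordering of \<open>E\<close> is a list in \<^const>\<open>permutations_of_set\<close> \<open>E\<close>; only the set of elements
  of a prefix matters for the objective. The maximum below is over a nonempty set if \<open>C \<ge> 0\<close>.\<close>

definition max_prefix :: "('a \<Rightarrow> real) \<Rightarrow> 'a list \<Rightarrow> real \<Rightarrow> 'a set" where
  "max_prefix w \<pi> C =
     set (take (Max {k. k \<le> length \<pi> \<and> sum w (set (take k \<pi>)) \<le> C}) \<pi>)"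

definition competitive ::
  "'a set \<Rightarrow> ('a \<Rightarrow> real) \<Rightarrow> ('a set \<Rightarrow> real) \<Rightarrow> real \<Rightarrow> 'a list \<Rightarrow> bool" where
  "competitive E w f \<rho> \<pi> \<longleftrightarrow> (\<forall>C>0. opt_value E w f C \<le> \<rho> * f (max_prefix w \<pi> C))"

definition one_bounded :: "'a set \<Rightarrow> ('a set \<Rightarrow> real) \<Rightarrow> bool" where
  "one_bounded E f \<longleftrightarrow> (\<forall>e\<in>E. f {e} = 1)"

definition fractionally_subadditive :: "'a set \<Rightarrow> ('a set \<Rightarrow> real) \<Rightarrow> bool" where
  "fractionally_subadditive E f \<longleftrightarrow>
     (\<forall>A (k::nat) (B :: nat \<Rightarrow> 'a set) (\<alpha> :: nat \<Rightarrow> real).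
        A \<subseteq> E \<longrightarrow> (\<forall>i<k. B i \<subseteq> E) \<longrightarrow> (\<forall>i<k. \<alpha> i \<ge> 0) \<longrightarrow>
        (\<forall>e\<in>A. (\<Sum>i\<in>{i. i < k \<and> e \<in> B i}. \<alpha> i) \<ge> 1) \<longrightarrow>
        f A \<le> (\<Sum>i<k. \<alpha> i * f (B i)))"

end

theory Submission
  imports Defs
begin

text \<open>The instance has a light element (\<open>0\<close>, weight 4), a medium block of three elements of weight 5
  and total value \<open>\<surd>6\<close>, and a heavy block of six elements of weight 6 and total value 6; the value
  of a nonempty set is the best of its value in one block and 1. A competitive ordering must start
  with the light element, which blocks enough capacity to force all further choices: at capacity 15
  two heavy elements do not fit, so two medium ones are present; at capacity 24 these leave no room
  for two heavy ones, so the medium block is complete; then at capacity 36 at most two heavy elements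
  fit, and the value is only \<open>\<surd>6\<close> while the optimum is 6.\<close>

text \<open>It suffices that at each \<open>A\<close> an additive function \<open>c\<close> with
  nonnegative coefficients lies below \<open>f\<close> everywhere and reaches \<open>f A\<close> on
  \<open>A\<close>. The cover condition inflates each \<open>c e\<close> to its total over the sets
  \<open>B i\<close> containing \<open>e\<close>; exchanging the sums leaves the terms
  \<open>\<alpha> i * sum c (A \<inter> B i)\<close>, and \<open>f\<close> dominates
  \<open>c\<close> on each \<open>B i\<close>.\<close>

lemma fractionally_subadditiveI:
  fixes f :: "'a set \<Rightarrow> real"
  assumes fin: "finite E"
    and supp: "\<And>A. A \<subseteq> E \<Longrightarrow>
      \<exists>c. (\<forall>e\<in>E. 0 \<le> c e) \<and> f A \<le> sum c A \<and> (\<forall>S\<subseteq>E. sum c S \<le> f S)"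
  shows "fractionally_subadditive E f"
  unfolding fractionally_subadditive_def
proof (intro allI impI)
  fix A and k :: nat and B :: "nat \<Rightarrow> 'a set" and \<alpha> :: "nat \<Rightarrow> real"
  assume A: "A \<subseteq> E" and B: "\<forall>i<k. B i \<subseteq> E" and \<alpha>: "\<forall>i<k. \<alpha> i \<ge> 0"
    and cover: "\<forall>e\<in>A. (\<Sum>i\<in>{i. i < k \<and> e \<in> B i}. \<alpha> i) \<ge> 1"
  obtain c where c: "\<forall>e\<in>E. 0 \<le> c e" "f A \<le> sum c A" "\<forall>S\<subseteq>E. sum c S \<le> f S"
    using supp[OF A] by blast
  have finA: "finite A" using A fin by (rule finite_subset)
  have "f A \<le> sum c A" by (fact c(2))
  also have "\<dots> \<le> (\<Sum>e\<in>A. c e * (\<Sum>i\<in>{i. i < k \<and> e \<in> B i}. \<alpha> i))"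
  proof (rule sum_mono)
    fix e assume "e \<in> A"
    then show "c e \<le> c e * (\<Sum>i\<in>{i. i < k \<and> e \<in> B i}. \<alpha> i)"
      using mult_left_mono[of 1 "\<Sum>i\<in>{i. i < k \<and> e \<in> B i}. \<alpha> i" "c e"] cover c(1) A by auto
  qed
  also have "\<dots> = (\<Sum>e\<in>A. \<Sum>i<k. if e \<in> B i then \<alpha> i * c e else 0)"
  proof (rule sum.cong[OF refl])
    fix e
    have "{i. i < k \<and> e \<in> B i} = {i \<in> {..<k}. e \<in> B i}" by auto
    then show "c e * (\<Sum>i\<in>{i. i < k \<and> e \<in> B i}. \<alpha> i)
        = (\<Sum>i<k. if e \<in> B i then \<alpha> i * c e else 0)"
      by (simp only: sum.inter_filter[symmetric] finite_lessThan sum_distrib_left mult.commute)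
  qed
  also have "\<dots> = (\<Sum>i<k. \<Sum>e\<in>A. if e \<in> B i then \<alpha> i * c e else 0)"
    by (rule sum.swap)
  also have "\<dots> = (\<Sum>i<k. \<alpha> i * sum c (A \<inter> B i))"
    by (intro sum.cong refl, subst sum.inter_restrict[OF finA])
      (simp add: sum_distrib_left if_distrib cong: if_cong)
  also have "\<dots> \<le> (\<Sum>i<k. \<alpha> i * f (B i))"
  proof (rule sum_mono)
    fix i assume "i \<in> {..<k}"
    then have i: "B i \<subseteq> E" "\<alpha> i \<ge> 0" using B \<alpha> by auto
    have "sum c (A \<inter> B i) \<le> sum c (B i)"
      using i(1) c(1) fin by (intro sum_mono2) (auto intro: finite_subset)
    also have "\<dots> \<le> f (B i)" using c(3) i(1) by blast
    finally show "\<alpha> i * sum c (A \<inter> B i) \<le> \<alpha> i * f (B i)"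
      using i(2) by (rule mult_left_mono)
  qed
  finally show "f A \<le> (\<Sum>i<k. \<alpha> i * f (B i))" .
qed

lemma opt_value_ge:
  assumes "finite E" "S \<subseteq> E" "sum w S \<le> C"
  shows "f S \<le> opt_value E w f C"
proof -
  have "finite {f S | S. S \<subseteq> E \<and> sum w S \<le> C}"
    by (rule finite_subset[of _ "f ` Pow E"]) (use assms(1) in auto)
  then show ?thesis unfolding opt_value_def using assms(2,3) by (intro Max_ge) auto
qed

lemma max_prefix_subset: "max_prefix w \<pi> C \<subseteq> set \<pi>"
  unfolding max_prefix_def by (rule set_take_subset)

lemma max_prefix_weight:
  assumes "0 \<le> C"
  shows "sum w (max_prefix w \<pi> C) \<le> C"
proof -
  let ?K = "{k. k \<le> length \<pi> \<and> sum w (set (take k \<pi>)) \<le> C}"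
  have "Max ?K \<in> ?K"
    \<comment> \<open>The empty prefix fits because \<open>C\<close> is nonnegative, so the maximum
      ranges over a nonempty set and is attained.\<close>
    using assms by (intro Max_in) (auto intro!: exI[of _ 0])
  then show ?thesis unfolding max_prefix_def by simp
qed

lemma max_prefix_mono:
  assumes "0 \<le> C" "C \<le> D"
  shows "max_prefix w \<pi> C \<subseteq> max_prefix w \<pi> D"
  unfolding max_prefix_def
  by (rule set_take_subset_set_take, rule Max_mono) (use assms in \<open>auto intro!: exI[of _ 0]\<close>)

definition block_weight :: "nat \<Rightarrow> real" where
  "block_weight e = (if e = 0 then 4 else if e < 4 then 5 else 6)"

text \<open>A maximum of additive functions: the scaled counts of the two blocks and the indicators
  of single elements. The latter yield the term 1, which lifts a single medium element from
  \<open>sqrt 6 / 3\<close> to the required value 1.\<close>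

definition block_value :: "nat set \<Rightarrow> real" where
  "block_value S = (if S = {} then 0 else
     max 1 (max (sqrt 6 / 3 * card (S \<inter> {1..3})) (card (S \<inter> {4..9}))))"

lemma block_value_nonneg: "0 \<le> block_value S"
  by (auto simp: block_value_def le_max_iff_disj)

lemma block_value_mono: "mono_on (Pow {..9}) block_value"
proof (rule mono_onI)
  fix S T :: "nat set" assume "S \<in> Pow {..9}" "T \<in> Pow {..9}" "S \<subseteq> T"
  then have "card (S \<inter> {1..3}) \<le> card (T \<inter> {1..3})" "card (S \<inter> {4..9}) \<le> card (T \<inter> {4..9})"
    by (auto intro!: card_mono)
  then have "max 1 (max (sqrt 6 / 3 * card (S \<inter> {1..3})) (card (S \<inter> {4..9})))
      \<le> max 1 (max (sqrt 6 / 3 * card (T \<inter> {1..3})) (card (T \<inter> {4..9})))"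
    by (intro max.mono mult_left_mono) auto
  then show "block_value S \<le> block_value T"
    using \<open>S \<subseteq> T\<close> block_value_nonneg[of T] by (cases "S = {}") (auto simp: block_value_def)
qed

lemma sqrt_6_less_3: "sqrt 6 < 3"
  by (rule real_less_lsqrt) auto

lemma one_bounded_block_value: "one_bounded {..9} block_value"
  unfolding one_bounded_def
proof
  fix e :: nat
  have "card ({e} \<inter> {1..3}) \<le> 1" "card ({e} \<inter> {4..9}) \<le> 1"
    by (rule order_trans[OF card_mono[of "{e}"]]; simp)+
  moreover from this(1) have "sqrt 6 / 3 * card ({e} \<inter> {1..3}) \<le> 1 * 1"
    using sqrt_6_less_3 by (intro mult_mono) auto
  ultimately show "block_value {e} = 1"
    unfolding block_value_def by simp
qed

lemma fractionally_subadditive_block_value: "fractionally_subadditive {..9} block_value"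
proof (rule fractionally_subadditiveI)
  fix A :: "nat set" assume A: "A \<subseteq> {..9}"
  have fin: "finite S" if "S \<subseteq> {..9::nat}" for S
    using that by (rule finite_subset) simp
  have scaled_indicator: "(\<Sum>e\<in>S. if e \<in> X then r else 0) = r * card (S \<inter> X)"
    if "S \<subseteq> {..9::nat}" for S X and r :: real
    using fin[OF that] by (simp add: sum.inter_restrict[symmetric] mult.commute)
  \<comment> \<open>All supporting functions needed are \<open>r\<close> times the indicator of some
    set \<open>X\<close>.\<close>
  have supporting: "\<exists>c. (\<forall>e\<in>{..9}. 0 \<le> c e) \<and> block_value A \<le> sum c A \<and>
      (\<forall>S\<subseteq>{..9}. sum c S \<le> block_value S)"
    if "0 \<le> r" "block_value A \<le> r * card (A \<inter> X)"
      "\<And>S. S \<subseteq> {..9} \<Longrightarrow> r * card (S \<inter> X) \<le> block_value S" for r :: real and X :: "nat set"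
    using that
    by (intro exI[of _ "\<lambda>e. if e \<in> X then r else 0"])
      (auto simp only: scaled_indicator A split: if_splits)
  show "\<exists>c. (\<forall>e\<in>{..9}. 0 \<le> c e) \<and> block_value A \<le> sum c A \<and>
      (\<forall>S\<subseteq>{..9}. sum c S \<le> block_value S)"
  proof (cases "A = {}")
    \<comment> \<open>For empty \<open>A\<close> the zero function supports.\<close>
    case True
    then show ?thesis
      by (intro supporting[of 0 "{}"]) (simp_all add: block_value_nonneg, simp add: block_value_def)
  next
    case False
    then obtain x where x: "x \<in> A" by blast
    consider "block_value A = 1"
      | "block_value A = sqrt 6 / 3 * card (A \<inter> {1..3})"
      | "block_value A = card (A \<inter> {4..9})"
      using False unfolding block_value_def by (metis max_def)
    then show ?thesis
    proof cases
      \<comment> \<open>The indicator of any one element of \<open>A\<close> supports, since every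
        set containing that element has value at least 1.\<close>
      case 1
      show ?thesis
      proof (rule supporting[of 1 "{x}"])
        show "block_value A \<le> 1 * real (card (A \<inter> {x}))" using 1 x by simp
        fix S :: "nat set"
        show "1 * real (card (S \<inter> {x})) \<le> block_value S"
          by (cases "x \<in> S") (auto simp: block_value_def)
      qed simp
    next
      case 2
      then show ?thesis
        by (intro supporting[of "sqrt 6 / 3" "{1..3}"]) (auto simp: block_value_def)
    next
      case 3
      then show ?thesis
        by (intro supporting[of 1 "{4..9}"]) (auto simp: block_value_def)
    qed
  qed
qed simp

lemma sum_block_weight:
  assumes "S \<subseteq> {..9}"
  shows "sum block_weight S
    = (if 0 \<in> S then 4 else 0 :: real) + 5 * card (S \<inter> {1..3}) + 6 * card (S \<inter> {4..9})"
proof -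
  have fin: "finite S" using assms by (rule finite_subset) simp
  have "sum block_weight S = (\<Sum>e\<in>S. (if e \<in> {0} then 4 else 0)
      + (if e \<in> {1..3} then 5 else 0) + (if e \<in> {4..9} then 6 else 0))"
    using assms by (intro sum.cong refl) (auto simp: block_weight_def)
  also have "\<dots> = sum (\<lambda>_. 4) (S \<inter> {0}) + sum (\<lambda>_. 5) (S \<inter> {1..3}) + sum (\<lambda>_. 6) (S \<inter> {4..9})"
    by (simp only: sum.distrib sum.inter_restrict[OF fin])
  finally show ?thesis by simp
qed

lemma not_competitive_block:
  assumes \<rho>: "\<rho> < sqrt 6" and \<pi>: "\<pi> \<in> permutations_of_set {..9}"
  shows "\<not> competitive {..9} block_weight block_value \<rho> \<pi>"
proof
  assume comp: "competitive {..9} block_weight block_value \<rho> \<pi>"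
  define P where "P = max_prefix block_weight \<pi>"
  define a where "a C = card (P C \<inter> {1..3})" for C
  define b where "b C = card (P C \<inter> {4..9})" for C
  have sub: "P C \<subseteq> {..9}" for C
    using max_prefix_subset[of block_weight \<pi> C] \<pi>
    by (simp add: P_def permutations_of_set_def)
  have fin: "finite (P C)" for C
    using sub by (rule finite_subset) simp
  have mono: "P C \<subseteq> P D" if "0 \<le> C" "C \<le> D" for C D
    unfolding P_def using that by (rule max_prefix_mono)
  have a_mono: "a C \<le> a D" if "0 \<le> C" "C \<le> D" for C D
    unfolding a_def using mono[OF that] fin by (intro card_mono) auto
  have weight: "(if 0 \<in> P C then 4 else 0) + 5 * real (a C) + 6 * real (b C) \<le> C"
    if "0 \<le> C" for C
    using max_prefix_weight[OF that, of block_weight \<pi>] sum_block_weight[OF sub, of C]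
    by (simp add: P_def a_def b_def)
  \<comment> \<open>Competitiveness with \<open>\<rho> < sqrt 6\<close> becomes a strict inequality
    because a positive value of \<open>S\<close> forces the prefix to have positive value. The
    strictness matters: the last two comparisons below would be ties.\<close>
  have beats: "block_value S < sqrt 6 * block_value (P C)"
    if "0 < C" "S \<subseteq> {..9}" "sum block_weight S \<le> C" "0 < block_value S" for S C
  proof -
    have le: "block_value S \<le> \<rho> * block_value (P C)"
      using opt_value_ge[OF _ that(2,3), of block_value] comp that(1)
      unfolding competitive_def P_def by fastforce
    then have "block_value (P C) \<noteq> 0" using that(4) by auto
    then have "0 < block_value (P C)" using block_value_nonneg[of "P C"] by linarith
    then show ?thesis using le \<rho> by (meson mult_strict_right_mono order_le_less_trans)
  qed
  \<comment> \<open>The set \<open>{0}\<close> fits and is worth 1, while the empty prefix is worth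
    0. Only the light element weighs at most 4.\<close>
  have "P 4 \<noteq> {}"
    using beats[of 4 "{0}"] by (auto simp: block_value_def block_weight_def)
  then obtain e where e: "e \<in> P 4" by blast
  have "a 4 = 0" "b 4 = 0"
    using weight[of 4] by (auto split: if_splits)
  then have "P 4 \<inter> {1..3} = {}" "P 4 \<inter> {4..9} = {}"
    using fin[of 4] unfolding a_def b_def by simp_all
  then have "e \<notin> {1..3}" "e \<notin> {4..9}" using e by blast+
  moreover have "e \<le> 9" using e sub[of 4] by auto
  ultimately have "e = 0" by auto
  with e have "0 \<in> P 4" by simp
  then have light: "0 \<in> P C" if "4 \<le> C" for C using mono[of 4 C] that by auto

  have two_le_sqrt_6: "2 \<le> sqrt 6" by (rule real_le_rsqrt) simp
  \<comment> \<open>Here \<open>k\<close> bounds the number of medium elements, and \<open>t\<close>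
    bounds each of the three terms of the maximum.\<close>
  have value_le: "block_value (P C) \<le> t"
    if "4 \<le> C" "a C \<le> k" "sqrt 6 / 3 * k \<le> t" "b C \<le> t" "1 \<le> t" for C and t :: real and k :: nat
  proof -
    have "sqrt 6 / 3 * a C \<le> sqrt 6 / 3 * k" using that(2) by (intro mult_left_mono) auto
    then have "sqrt 6 / 3 * a C \<le> t" using that(3) by (rule order_trans)
    then show ?thesis using that(4,5) light[OF that(1)]
      by (auto simp: block_value_def a_def b_def)
  qed

  \<comment> \<open>The medium block weighs exactly 15, but the light element and two heavy ones
    weigh 16. With at most one element from each block the prefix is worth at most 1, which loses
    against \<open>sqrt 6\<close>.\<close>
  have "2 \<le> a 15"
  proof (rule ccontr)
    assume "\<not> 2 \<le> a 15"
    moreover have "b 15 \<le> 1" using weight[of 15] light[of 15] by simp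
    ultimately have "block_value (P 15) \<le> 1"
      using sqrt_6_less_3 by (intro value_le[where k = 1]) simp_all
    moreover have "sqrt 6 < sqrt 6 * block_value (P 15)"
      using beats[of 15 "{1..3}"] two_le_sqrt_6 by (simp add: block_value_def sum_block_weight)
    ultimately show False by simp
  qed
  then have "2 \<le> a 24" using a_mono[of 15 24] by simp
  \<comment> \<open>One light, two medium and two heavy elements weigh 4 + 10 + 12 = 26.\<close>
  then have b24: "b 24 \<le> 1" using weight[of 24] light[of 24] by simp
  \<comment> \<open>Four heavy elements weigh 24 and are worth 4. Two medium ones are worth
    \<open>sqrt 6 / 3 * 2\<close>, exactly \<open>4 / sqrt 6\<close>.\<close>
  have "3 \<le> a 24"
  proof (rule ccontr)
    assume "\<not> 3 \<le> a 24"
    then have "block_value (P 24) \<le> sqrt 6 / 3 * 2"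
      using b24 two_le_sqrt_6 by (intro value_le[where k = 2]) simp_all
    then have "sqrt 6 * block_value (P 24) \<le> sqrt 6 * (sqrt 6 / 3 * 2)"
      by (rule mult_left_mono) simp
    also have "\<dots> = 4" by simp
    finally have "sqrt 6 * block_value (P 24) \<le> 4" .
    moreover have "4 < sqrt 6 * block_value (P 24)"
      using beats[of 24 "{4..7}"] sqrt_6_less_3 by (simp add: block_value_def sum_block_weight)
    ultimately show False by linarith
  qed
  then have "3 \<le> a 36" using a_mono[of 24 36] by simp
  \<comment> \<open>A third heavy element would bring the weight to 4 + 15 + 18 = 37. The heavy
    block alone weighs 36 and is worth 6, exactly \<open>sqrt 6\<close> times the value
    \<open>sqrt 6\<close> of the medium block.\<close>
  then have "b 36 \<le> 2" using weight[of 36] light[of 36] by simp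
  moreover have "a 36 \<le> 3"
    unfolding a_def by (rule order_trans[OF card_mono[of "{1..3}"]]) auto
  ultimately have "block_value (P 36) \<le> sqrt 6"
    using two_le_sqrt_6 by (intro value_le[where k = 3]) simp_all
  then have "sqrt 6 * block_value (P 36) \<le> sqrt 6 * sqrt 6"
    by (rule mult_left_mono) simp
  also have "\<dots> = 6" by simp
  finally have "sqrt 6 * block_value (P 36) \<le> 6" .
  moreover have "6 < sqrt 6 * block_value (P 36)"
    using beats[of 36 "{4..9}"] sqrt_6_less_3 by (simp add: block_value_def sum_block_weight)
  ultimately show False by linarith
qed

theorem theorem3:
  fixes \<rho> :: real
  assumes "\<rho> < sqrt 6"
  shows "\<exists>(E :: nat set) (w :: nat \<Rightarrow> real) (f :: nat set \<Rightarrow> real).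
           finite E \<and>
           (\<forall>e\<in>E. w e \<ge> 0) \<and>
           (\<forall>S\<subseteq>E. f S \<ge> 0) \<and>
           mono_on (Pow E) f \<and>
           one_bounded E f \<and>
           fractionally_subadditive E f \<and>
           (\<nexists>\<pi>. \<pi> \<in> permutations_of_set E \<and> competitive E w f \<rho> \<pi>)"
  using block_value_nonneg block_value_mono one_bounded_block_value
    fractionally_subadditive_block_value not_competitive_block[OF assms]
  by (intro exI[of _ "{..9}"] exI[of _ block_weight] exI[of _ block_value])
    (auto simp: block_weight_def)

end
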